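(* For each prime number $p$ there exists $\widehat\alpha\in\Delta_{\mathcal H_p}$ (regarded as an element of $\widehat\Delta_{\mathcal H}$) such that the set $\Gamma_{\mathcal H}\backslash\eta_{\mathcal H}^{-1}(\widehat\Gamma_{\mathcal H}\widehat\alpha\widehat\Gamma_{\mathcal H})/\Gamma_{\mathcal H}$ has more than one element.
   Context: The Heisenberg Lie algebra $\mathcal H$ is the quotient of the free Lie algebra over $\mathbb Z$ on two generators by $[L_2,[L_2,L_2]]$. $\Delta_{\mathcal H}=\mathrm{End}^{alg}_{\mathbb Z}(\mathcal H)\cap\mathrm{Aut}^{alg}_{\mathbb Q}(\mathcal H\otimes\mathbb Q)$ and $\Gamma_{\mathcal H}=\mathrm{Aut}^{alg}_{\mathbb Z}(\mathcal H)$ are identified with $(M_2(\mathbb Z)\cap GL_2(\mathbb Q))\times\mathbb Z^2$ and $GL_2(\mathbb Z)\times\mathbb Z^2$ in the group $GL_2(\mathbb Q)\times\mathbb Q^2$ with product $(A,\mathbf a)(B,\mathbf b)=(AB,A\mathbf b+\det(B)\mathbf a)$; for each prime $q$, $\Delta_{\mathcal H_q}=(M_2(\mathbb Z_q)\cap GL_2(\mathbb Q_q))\times\mathbb Z_q^2$, $\Gamma_{\mathcal H_q}=GL_2(\mathbb Z_q)\times\mathbb Z_q^2$ with the same product. $\widehat\Gamma_{\mathcal H}=\prod_q\Gamma_{\mathcal H_q}$; $\widehat\Delta_{\mathcal H}$ is the set of $(\alpha_q)\in\prod_q\Delta_{\mathcal H_q}$ with $\alpha_q\in\Gamma_{\mathcal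 H_q}$ for almost all $q$; $\Delta_{\mathcal H_p}\subset\widehat\Delta_{\mathcal H}$ by putting the identity in the components $q\ne p$. $\eta_{\mathcal H}:\Delta_{\mathcal H}\to\widehat\Delta_{\mathcal H}$ is the diagonal embedding. *)

theory Defs
  imports "HOL-Algebra.QuotRing" "HOL-Algebra.Subrings" "HOL-Algebra.Product_Groups"
    "HOL-Computational_Algebra.Primes" Complex_Main
begin

section \<open>The fields of rational and of q-adic numbers\<close>

definition rat_field :: "rat ring" where
  "rat_field = \<lparr>carrier = UNIV, monoid.mult = (*), one = 1, zero = 0, add = (+)\<rparr>"

definition qadic_val :: "nat \<Rightarrow> rat \<Rightarrow> int" where
  "qadic_val q x = int (multiplicity (int q) (fst (quotient_of x)))
                 - int (multiplicity (int q) (snd (quotient_of x)))"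

definition qadic_abs :: "nat \<Rightarrow> rat \<Rightarrow> real" where
  "qadic_abs q x = (if x = 0 then 0 else real q powi (- qadic_val q x))"

definition qadic_cauchy :: "nat \<Rightarrow> (nat \<Rightarrow> rat) ring" where
  "qadic_cauchy q =
     \<lparr>carrier = {x. \<forall>e>0. \<exists>N. \<forall>m\<ge>N. \<forall>n\<ge>N. qadic_abs q (x m - x n) < e},
      monoid.mult = (\<lambda>x y n. x n * y n), one = (\<lambda>n. 1), zero = (\<lambda>n. 0), add = (\<lambda>x y n. x n + y n)\<rparr>"

definition qadic_null :: "nat \<Rightarrow> (nat \<Rightarrow> rat) set" where
  "qadic_null q = {x. (\<lambda>n. qadic_abs q (x n)) \<longlonglongrightarrow> 0}"

definition qadic_field :: "nat \<Rightarrow> (nat \<Rightarrow> rat) set ring" where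
  "qadic_field q = qadic_cauchy q Quot qadic_null q"

definition rat_to_qadic :: "nat \<Rightarrow> rat \<Rightarrow> (nat \<Rightarrow> rat) set" where
  "rat_to_qadic q r = qadic_null q +>\<^bsub>qadic_cauchy q\<^esub> (\<lambda>n. r)"

text \<open>The closed unit ball of the q-adic field; as the absolute value is discrete, every element
  of absolute value at most 1 has a representative all of whose terms satisfy the same bound.\<close>

definition qadic_integers :: "nat \<Rightarrow> (nat \<Rightarrow> rat) set set" where
  "qadic_integers q = {X \<in> carrier (qadic_field q). \<exists>x\<in>X. \<forall>n. qadic_abs q (x n) \<le> 1}"

section \<open>Two by two matrices over a ring\<close>

text \<open>A matrix is the pair of its rows.\<close>

type_synonym 'a vec2 = "'a \<times> 'a"
type_synonym 'a mat2 = "('a \<times> 'a) \<times> ('a \<times> 'a)"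

definition mat2_det :: "('a, 'm) ring_scheme \<Rightarrow> 'a mat2 \<Rightarrow> 'a" where
  "mat2_det R = (\<lambda>((a, b), (c, d)). (a \<otimes>\<^bsub>R\<^esub> d) \<ominus>\<^bsub>R\<^esub> (b \<otimes>\<^bsub>R\<^esub> c))"

definition mat2_vec :: "('a, 'm) ring_scheme \<Rightarrow> 'a mat2 \<Rightarrow> 'a vec2 \<Rightarrow> 'a vec2" where
  "mat2_vec R = (\<lambda>((a, b), (c, d)) (x, y).
     (a \<otimes>\<^bsub>R\<^esub> x \<oplus>\<^bsub>R\<^esub> b \<otimes>\<^bsub>R\<^esub> y, c \<otimes>\<^bsub>R\<^esub> x \<oplus>\<^bsub>R\<^esub> d \<otimes>\<^bsub>R\<^esub> y))"

definition vec2_add :: "('a, 'm) ring_scheme \<Rightarrow> 'a vec2 \<Rightarrow> 'a vec2 \<Rightarrow> 'a vec2" where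
  "vec2_add R = (\<lambda>(x, y) (x', y'). (x \<oplus>\<^bsub>R\<^esub> x', y \<oplus>\<^bsub>R\<^esub> y'))"

definition vec2_smult :: "('a, 'm) ring_scheme \<Rightarrow> 'a \<Rightarrow> 'a vec2 \<Rightarrow> 'a vec2" where
  "vec2_smult R = (\<lambda>c (x, y). (c \<otimes>\<^bsub>R\<^esub> x, c \<otimes>\<^bsub>R\<^esub> y))"

definition mat2 :: "('a, 'm) ring_scheme \<Rightarrow> 'a mat2 monoid" where
  "mat2 R =
     \<lparr>carrier = (carrier R \<times> carrier R) \<times> (carrier R \<times> carrier R),
      monoid.mult = (\<lambda>((a, b), (c, d)) ((a', b'), (c', d')).
        ((a \<otimes>\<^bsub>R\<^esub> a' \<oplus>\<^bsub>R\<^esub> b \<otimes>\<^bsub>R\<^esub> c', a \<otimes>\<^bsub>R\<^esub> b' \<oplus>\<^bsub>R\<^esub> b \<otimes>\<^bsub>R\<^esub> d'),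
         (c \<otimes>\<^bsub>R\<^esub> a' \<oplus>\<^bsub>R\<^esub> d \<otimes>\<^bsub>R\<^esub> c', c \<otimes>\<^bsub>R\<^esub> b' \<oplus>\<^bsub>R\<^esub> d \<otimes>\<^bsub>R\<^esub> d'))),
      one = ((\<one>\<^bsub>R\<^esub>, \<zero>\<^bsub>R\<^esub>), (\<zero>\<^bsub>R\<^esub>, \<one>\<^bsub>R\<^esub>))\<rparr>"

abbreviation GL2 :: "('a, 'm) ring_scheme \<Rightarrow> 'a mat2 set" where
  "GL2 R \<equiv> Units (mat2 R)"

section \<open>The monoids attached to the Heisenberg Lie algebra\<close>

text \<open>With a basis \<open>x\<^sub>1, x\<^sub>2, z = [x\<^sub>1, x\<^sub>2]\<close> of the Heisenberg Lie algebra, \<open>(A, a)\<close> stands for the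
  endomorphism that sends \<open>x\<^sub>i\<close> to \<open>A\<^sub>i\<^sub>1 x\<^sub>1 + A\<^sub>i\<^sub>2 x\<^sub>2 + a\<^sub>i z\<close> and hence \<open>z\<close> to \<open>det A z\<close>; in
  \<open>(A, a) (B, b)\<close> the endomorphism \<open>(A, a)\<close> is applied first.\<close>

definition heis :: "('a, 'm) ring_scheme \<Rightarrow> ('a mat2 \<times> 'a vec2) monoid" where
  "heis K =
     \<lparr>carrier = GL2 K \<times> (carrier K \<times> carrier K),
      monoid.mult = (\<lambda>(A, a) (B, b).
        (A \<otimes>\<^bsub>mat2 K\<^esub> B, vec2_add K (mat2_vec K A b) (vec2_smult K (mat2_det K B) a))),
      one = (\<one>\<^bsub>mat2 K\<^esub>, (\<zero>\<^bsub>K\<^esub>, \<zero>\<^bsub>K\<^esub>))\<rparr>"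

text \<open>In the next two definitions \<open>Z\<close> is a subring of the field \<open>K\<close>.\<close>

definition heis_Delta :: "('a, 'm) ring_scheme \<Rightarrow> 'a set \<Rightarrow> ('a mat2 \<times> 'a vec2) set" where
  "heis_Delta K Z = (carrier (mat2 (K\<lparr>carrier := Z\<rparr>)) \<inter> GL2 K) \<times> (Z \<times> Z)"

definition heis_Gamma :: "('a, 'm) ring_scheme \<Rightarrow> 'a set \<Rightarrow> ('a mat2 \<times> 'a vec2) set" where
  "heis_Gamma K Z = GL2 (K\<lparr>carrier := Z\<rparr>) \<times> (Z \<times> Z)"

definition Delta_H :: "(rat mat2 \<times> rat vec2) set" where
  "Delta_H = heis_Delta rat_field \<int>"

definition Gamma_H :: "(rat mat2 \<times> rat vec2) set" where
  "Gamma_H = heis_Gamma rat_field \<int>"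

type_synonym qadic_heis = "(nat \<Rightarrow> rat) set mat2 \<times> (nat \<Rightarrow> rat) set vec2"

definition Delta_Hq :: "nat \<Rightarrow> qadic_heis set" where
  "Delta_Hq q = heis_Delta (qadic_field q) (qadic_integers q)"

definition Gamma_Hq :: "nat \<Rightarrow> qadic_heis set" where
  "Gamma_Hq q = heis_Gamma (qadic_field q) (qadic_integers q)"

definition heis_hat :: "(nat \<Rightarrow> qadic_heis) monoid" where
  "heis_hat = product_group {q. prime q} (\<lambda>q. heis (qadic_field q))"

definition Gamma_hat :: "(nat \<Rightarrow> qadic_heis) set" where
  "Gamma_hat = (\<Pi>\<^sub>E q\<in>{q. prime q}. Gamma_Hq q)"

definition Delta_hat :: "(nat \<Rightarrow> qadic_heis) set" where
  "Delta_hat = {\<alpha> \<in> (\<Pi>\<^sub>E q\<in>{q. prime q}. Delta_Hq q). finite {q. prime q \<and> \<alpha> q \<notin> Gamma_Hq q}}"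

definition local_embed :: "nat \<Rightarrow> qadic_heis \<Rightarrow> (nat \<Rightarrow> qadic_heis)" where
  "local_embed p a = (\<lambda>q\<in>{q. prime q}. if q = p then a else \<one>\<^bsub>heis (qadic_field q)\<^esub>)"

definition eta_H :: "rat mat2 \<times> rat vec2 \<Rightarrow> (nat \<Rightarrow> qadic_heis)" where
  "eta_H x = (\<lambda>q\<in>{q. prime q}.
     let i = rat_to_qadic q in
     map_prod (map_prod (map_prod i i) (map_prod i i)) (map_prod i i) x)"

section \<open>Double cosets\<close>

definition double_coset :: "('a, 'm) monoid_scheme \<Rightarrow> 'a set \<Rightarrow> 'a \<Rightarrow> 'a set" where
  "double_coset G H x = {g \<otimes>\<^bsub>G\<^esub> x \<otimes>\<^bsub>G\<^esub> h |g h. g \<in> H \<and> h \<in> H}"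

text \<open>The double cosets contained in a set \<open>X\<close> that is stable under \<open>H\<close> on both sides.\<close>

definition double_cosets :: "('a, 'm) monoid_scheme \<Rightarrow> 'a set \<Rightarrow> 'a set \<Rightarrow> 'a set set" where
  "double_cosets G H X = double_coset G H ` X"

definition eta_fibre :: "(nat \<Rightarrow> qadic_heis) \<Rightarrow> (rat mat2 \<times> rat vec2) set" where
  "eta_fibre \<alpha> = {x \<in> Delta_H. eta_H x \<in> double_coset heis_hat Gamma_hat \<alpha>}"

section \<open>Properties of the q-adic numbers\<close>

lemma qadic_abs_zero [simp]: "qadic_abs q 0 = 0"
  by (simp add: qadic_abs_def)

context
  fixes q :: nat
  assumes q: "prime q"
begin

lemma qadic_prime_gt: "real q > 1"
  using prime_gt_1_nat[OF q] by simp

lemma qadic_prime_elem: "prime_elem (int q)"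
  using q by simp

lemma qadic_abs_pos: "x \<noteq> 0 \<Longrightarrow> qadic_abs q x > 0"
  using qadic_prime_gt by (simp add: qadic_abs_def)

lemma qadic_abs_nonneg [simp]: "qadic_abs q x \<ge> 0"
  by (cases "x = 0") (auto simp: less_imp_le[OF qadic_abs_pos])

lemma qadic_abs_eq_0_iff [simp]: "qadic_abs q x = 0 \<longleftrightarrow> x = 0"
  using qadic_abs_pos[of x] by fastforce

lemma qadic_val_fract:
  assumes "a \<noteq> 0" "b \<noteq> 0"
  shows "qadic_val q (of_int a / of_int b) = int (multiplicity (int q) a) - int (multiplicity (int q) b)"
proof -
  let ?m = "multiplicity (int q)"
  obtain n d where nd: "quotient_of (of_int a / of_int b) = (n, d)" by fastforce
  have d: "d > 0" using quotient_of_denom_pos[OF nd] .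
  have "(of_int a / of_int b :: rat) = of_int n / of_int d" using quotient_of_div[OF nd] .
  then have "(of_int (a * d) :: rat) = of_int (n * b)" using d assms by (simp add: field_simps)
  then have e: "a * d = n * b" by (simp only: of_int_eq_iff)
  then have n: "n \<noteq> 0" using assms d by auto
  have "?m a + ?m d = ?m n + ?m b"
    using e assms d n qadic_prime_elem by (metis prime_elem_multiplicity_mult_distrib less_irrefl)
  then show ?thesis using nd by (simp add: qadic_val_def)
qed

lemma qadic_abs_fract:
  assumes "a \<noteq> 0" "b \<noteq> 0"
  shows "qadic_abs q (of_int a / of_int b) = real q ^ multiplicity (int q) b / real q ^ multiplicity (int q) a"
  using assms qadic_prime_gt by (simp add: qadic_abs_def qadic_val_fract power_int_diff)

lemma qadic_abs_of_int:
  assumes "a \<noteq> 0"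
  shows "qadic_abs q (of_int a) = 1 / real q ^ multiplicity (int q) a"
  using qadic_abs_fract[OF assms, of 1] by simp

lemma qadic_abs_one [simp]: "qadic_abs q 1 = 1"
  using qadic_abs_of_int[of 1] by simp

lemma qadic_abs_mult: "qadic_abs q (x * y) = qadic_abs q x * qadic_abs q y"
proof (cases "x = 0 \<or> y = 0")
  case False
  obtain a b where x: "x = of_int a / of_int b" "b \<noteq> 0"
    by (metis quotient_of_div quotient_of_denom_pos surj_pair less_irrefl)
  obtain c d where y: "y = of_int c / of_int d" "d \<noteq> 0"
    by (metis quotient_of_div quotient_of_denom_pos surj_pair less_irrefl)
  have nz: "a \<noteq> 0" "c \<noteq> 0" using False x y by auto
  have "x * y = of_int (a * c) / of_int (b * d)" using x y by simp
  then have "qadic_abs q (x * y) = qadic_abs q (of_int (a * c) / of_int (b * d))" by simp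
  also have "\<dots> = qadic_abs q x * qadic_abs q y"
    using x y nz qadic_prime_elem by (subst qadic_abs_fract)
      (simp_all add: qadic_abs_fract prime_elem_multiplicity_mult_distrib power_add del: of_int_mult)
  finally show ?thesis .
qed auto

lemma qadic_abs_minus [simp]: "qadic_abs q (- x) = qadic_abs q x"
proof -
  have "qadic_abs q (-1) = 1" using qadic_abs_of_int[of "-1"]
    by (simp add: multiplicity_unit_right)
  then show ?thesis using qadic_abs_mult[of "-1" x] by simp
qed

lemma qadic_abs_of_int_le: "qadic_abs q (of_int a) \<le> 1"
  using qadic_prime_gt by (cases "a = 0") (auto simp: qadic_abs_of_int)

lemma qadic_abs_add: "qadic_abs q (x + y) \<le> max (qadic_abs q x) (qadic_abs q y)"
proof -
  have i: "qadic_abs q (of_int (a + b)) \<le> max (qadic_abs q (of_int a)) (qadic_abs q (of_int b))" for a b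
  proof (cases "a = 0 \<or> b = 0 \<or> a + b = 0")
    case False
    let ?m = "multiplicity (int q)"
    let ?k = "min (?m a) (?m b)"
    have "int q ^ ?k dvd a + b"
      by (intro dvd_add) (auto intro: multiplicity_dvd')
    moreover have "\<not> is_unit (int q)" using prime_gt_1_nat[OF q] by simp
    ultimately have "?k \<le> ?m (a + b)" using False by (intro multiplicity_geI) auto
    then have "?m a \<le> ?m (a + b) \<or> ?m b \<le> ?m (a + b)" by linarith
    then have "1 / real q ^ ?m (a + b) \<le> 1 / real q ^ ?m a \<or> 1 / real q ^ ?m (a + b) \<le> 1 / real q ^ ?m b"
      using qadic_prime_gt by (auto simp: divide_simps power_increasing)
    then show ?thesis
      using False by (auto simp: qadic_abs_of_int le_max_iff_disj simp del: of_int_add)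
  next
    case True
    then consider "a = 0" | "b = 0" | "a + b = 0" by blast
    then show ?thesis by cases (auto simp: le_max_iff_disj simp del: of_int_add)
  qed
  obtain a b where x: "x = of_int a / of_int b" "b \<noteq> 0"
    by (metis quotient_of_div quotient_of_denom_pos surj_pair less_irrefl)
  obtain c d where y: "y = of_int c / of_int d" "d \<noteq> 0"
    by (metis quotient_of_div quotient_of_denom_pos surj_pair less_irrefl)
  let ?z = "1 / of_int (b * d) :: rat"
  have e: "x = of_int (a * d) * ?z" "y = of_int (c * b) * ?z" "x + y = of_int (a * d + c * b) * ?z"
    using x y by (simp_all add: field_simps)
  show ?thesis unfolding e(3) unfolding e(1,2) qadic_abs_mult
    using mult_right_mono[OF i[of "a * d" "c * b"] qadic_abs_nonneg[of ?z]]
    by (simp add: max_mult_distrib_right del: of_int_add of_int_mult)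
qed

lemma qadic_abs_diff: "qadic_abs q (x - y) \<le> max (qadic_abs q x) (qadic_abs q y)"
  using qadic_abs_add[of x "-y"] by simp

lemma qadic_abs_inverse: "qadic_abs q (inverse x) = inverse (qadic_abs q x)"
  by (cases "x = 0") (simp_all, metis qadic_abs_mult qadic_abs_one inverse_unique right_inverse)

private abbreviation (input) "CS \<equiv> carrier (qadic_cauchy q)"

lemma qadic_cauchy_iff: "x \<in> CS \<longleftrightarrow> (\<forall>e>0. \<exists>N. \<forall>m\<ge>N. \<forall>n\<ge>N. qadic_abs q (x m - x n) < e)"
  by (simp add: qadic_cauchy_def)

lemma qadic_cauchy_simps:
  "x \<otimes>\<^bsub>qadic_cauchy q\<^esub> y = (\<lambda>n. x n * y n)" "x \<oplus>\<^bsub>qadic_cauchy q\<^esub> y = (\<lambda>n. x n + y n)"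
  "\<one>\<^bsub>qadic_cauchy q\<^esub> = (\<lambda>n. 1)" "\<zero>\<^bsub>qadic_cauchy q\<^esub> = (\<lambda>n. 0)"
  by (simp_all add: qadic_cauchy_def)

lemma qadic_null_iff: "x \<in> qadic_null q \<longleftrightarrow> (\<forall>e>0. \<exists>N. \<forall>n\<ge>N. qadic_abs q (x n) < e)"
  by (simp add: qadic_null_def LIMSEQ_iff)

lemma qadic_cauchy_const [simp]: "(\<lambda>n. r) \<in> CS"
  by (simp add: qadic_cauchy_iff)

lemma qadic_cauchy_minus: "x \<in> CS \<Longrightarrow> (\<lambda>n. - x n) \<in> CS"
  unfolding qadic_cauchy_iff using qadic_abs_minus[of "x _ - x _"] by simp

lemma qadic_cauchy_add: assumes "x \<in> CS" "y \<in> CS" shows "(\<lambda>n. x n + y n) \<in> CS"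
  unfolding qadic_cauchy_iff
proof (intro allI impI)
  fix e :: real assume e: "e > 0"
  obtain N1 where 1: "\<forall>m\<ge>N1. \<forall>n\<ge>N1. qadic_abs q (x m - x n) < e" using assms e unfolding qadic_cauchy_iff by blast
  obtain N2 where 2: "\<forall>m\<ge>N2. \<forall>n\<ge>N2. qadic_abs q (y m - y n) < e" using assms e unfolding qadic_cauchy_iff by blast
  have "qadic_abs q (x m + y m - (x n + y n)) < e" if "m \<ge> max N1 N2" "n \<ge> max N1 N2" for m n
  proof -
    have "x m + y m - (x n + y n) = (x m - x n) + (y m - y n)" by simp
    moreover have "qadic_abs q (x m - x n) < e" "qadic_abs q (y m - y n) < e" using 1 2 that by auto
    ultimately show ?thesis using qadic_abs_add[of "x m - x n" "y m - y n"]
      by (metis le_less_trans max_less_iff_conj)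
  qed
  then show "\<exists>N. \<forall>m\<ge>N. \<forall>n\<ge>N. qadic_abs q (x m + y m - (x n + y n)) < e" by blast
qed

lemma qadic_cauchy_bounded: assumes "x \<in> CS" obtains M where "M > 0" "\<And>n. qadic_abs q (x n) \<le> M"
proof -
  obtain N where N: "\<forall>m\<ge>N. \<forall>n\<ge>N. qadic_abs q (x m - x n) < 1" using assms unfolding qadic_cauchy_iff by (meson zero_less_one)
  define M where "M = Max ((\<lambda>n. qadic_abs q (x n)) ` {..N}) + 1"
  have le: "qadic_abs q (x n) + 1 \<le> M" if "n \<le> N" for n unfolding M_def using that by auto
  have M1: "1 \<le> M" using le[of N] qadic_abs_nonneg[of "x N"] by linarith
  have "qadic_abs q (x n) \<le> M" for n
  proof (cases "n \<le> N")
    case False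
    then have "qadic_abs q (x n - x N) < 1" using N by simp
    then show ?thesis using qadic_abs_add[of "x n - x N" "x N"] le[of N] M1 by auto
  qed (use le in fastforce)
  with M1 that[of M] show ?thesis by simp
qed

lemma qadic_cauchy_mult: assumes "x \<in> CS" "y \<in> CS" shows "(\<lambda>n. x n * y n) \<in> CS"
  unfolding qadic_cauchy_iff
proof (intro allI impI)
  fix e :: real assume e: "e > 0"
  obtain M1 where M1: "M1 > 0" "\<And>n. qadic_abs q (x n) \<le> M1" using qadic_cauchy_bounded[OF assms(1)] by blast
  obtain M2 where M2: "M2 > 0" "\<And>n. qadic_abs q (y n) \<le> M2" using qadic_cauchy_bounded[OF assms(2)] by blast
  obtain N1 where 1: "\<forall>m\<ge>N1. \<forall>n\<ge>N1. qadic_abs q (x m - x n) < e / M2"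
    using assms e M2(1) unfolding qadic_cauchy_iff by (meson divide_pos_pos)
  obtain N2 where 2: "\<forall>m\<ge>N2. \<forall>n\<ge>N2. qadic_abs q (y m - y n) < e / M1"
    using assms e M1(1) unfolding qadic_cauchy_iff by (meson divide_pos_pos)
  have "qadic_abs q (x m * y m - x n * y n) < e" if "m \<ge> max N1 N2" "n \<ge> max N1 N2" for m n
  proof -
    have "x m * y m - x n * y n = (x m - x n) * y m + x n * (y m - y n)" by (simp add: algebra_simps)
    moreover have "qadic_abs q ((x m - x n) * y m) < e"
    proof -
      have "qadic_abs q ((x m - x n) * y m) \<le> qadic_abs q (x m - x n) * M2"
        by (simp add: qadic_abs_mult mult_left_mono M2)
      also have "\<dots> < e" using 1 that M2(1) by (simp add: pos_less_divide_eq)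
      finally show ?thesis .
    qed
    moreover have "qadic_abs q (x n * (y m - y n)) < e"
    proof -
      have "qadic_abs q (x n * (y m - y n)) \<le> M1 * qadic_abs q (y m - y n)"
        by (simp add: qadic_abs_mult mult_right_mono M1)
      also have "\<dots> < e" using 2 that M1(1) by (simp add: pos_less_divide_eq mult.commute)
      finally show ?thesis .
    qed
    ultimately show ?thesis
      using qadic_abs_add[of "(x m - x n) * y m" "x n * (y m - y n)"] by simp
  qed
  then show "\<exists>N. \<forall>m\<ge>N. \<forall>n\<ge>N. qadic_abs q (x m * y m - x n * y n) < e" by blast
qed

lemma qadic_null_add: assumes "x \<in> qadic_null q" "y \<in> qadic_null q" shows "(\<lambda>n. x n + y n) \<in> qadic_null q"
  unfolding qadic_null_iff
proof (intro allI impI)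
  fix e :: real assume e: "e > 0"
  obtain N1 where 1: "\<forall>n\<ge>N1. qadic_abs q (x n) < e" using assms e unfolding qadic_null_iff by blast
  obtain N2 where 2: "\<forall>n\<ge>N2. qadic_abs q (y n) < e" using assms e unfolding qadic_null_iff by blast
  have "qadic_abs q (x n + y n) < e" if "n \<ge> max N1 N2" for n
    using qadic_abs_add[of "x n" "y n"] 1 2 that by (smt (verit) max.bounded_iff)
  then show "\<exists>N. \<forall>n\<ge>N. qadic_abs q (x n + y n) < e" by blast
qed

lemma qadic_null_minus: "x \<in> qadic_null q \<Longrightarrow> (\<lambda>n. - x n) \<in> qadic_null q"
  by (simp add: qadic_null_iff)

lemma qadic_null_cauchy: assumes "x \<in> qadic_null q" shows "x \<in> CS"
  unfolding qadic_cauchy_iff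
proof (intro allI impI)
  fix e :: real assume e: "e > 0"
  obtain N where N: "\<forall>n\<ge>N. qadic_abs q (x n) < e" using assms e unfolding qadic_null_iff by blast
  have "qadic_abs q (x m - x n) < e" if "m \<ge> N" "n \<ge> N" for m n
    using qadic_abs_diff[of "x m" "x n"] N that by (smt (verit))
  then show "\<exists>N. \<forall>m\<ge>N. \<forall>n\<ge>N. qadic_abs q (x m - x n) < e" by blast
qed

lemma qadic_null_mult: assumes "x \<in> qadic_null q" "y \<in> CS" shows "(\<lambda>n. y n * x n) \<in> qadic_null q"
  unfolding qadic_null_iff
proof (intro allI impI)
  fix e :: real assume e: "e > 0"
  obtain M where M: "M > 0" "\<And>n. qadic_abs q (y n) \<le> M" using qadic_cauchy_bounded[OF assms(2)] by blast
  obtain N where N: "\<forall>n\<ge>N. qadic_abs q (x n) < e / M" using assms e M(1) unfolding qadic_null_iff by (meson divide_pos_pos)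
  have "qadic_abs q (y n * x n) < e" if "n \<ge> N" for n
  proof -
    have "qadic_abs q (y n * x n) \<le> M * qadic_abs q (x n)"
      by (simp add: qadic_abs_mult mult_right_mono M)
    also have "\<dots> < e" using N that M(1) by (simp add: pos_less_divide_eq mult.commute)
    finally show ?thesis .
  qed
  then show "\<exists>N. \<forall>n\<ge>N. qadic_abs q (y n * x n) < e" by blast
qed

lemma cring_qadic_cauchy: "cring (qadic_cauchy q)"
proof (rule cringI)
  show "abelian_group (qadic_cauchy q)"
  proof (rule abelian_groupI)
    fix x assume "x \<in> CS"
    then show "\<exists>y\<in>CS. y \<oplus>\<^bsub>qadic_cauchy q\<^esub> x = \<zero>\<^bsub>qadic_cauchy q\<^esub>"
      by (intro bexI[of _ "\<lambda>n. - x n"]) (auto simp: qadic_cauchy_simps qadic_cauchy_minus)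
  qed (auto simp: qadic_cauchy_simps qadic_cauchy_add algebra_simps)
  show "comm_monoid (qadic_cauchy q)"
    by (rule comm_monoidI) (auto simp: qadic_cauchy_simps qadic_cauchy_mult algebra_simps)
qed (auto simp: qadic_cauchy_simps algebra_simps)

lemma qadic_cauchy_uminus: assumes "x \<in> CS" shows "\<ominus>\<^bsub>qadic_cauchy q\<^esub> x = (\<lambda>n. - x n)"
proof -
  interpret cring "qadic_cauchy q" by (rule cring_qadic_cauchy)
  show ?thesis by (rule minus_equality) (auto simp: qadic_cauchy_simps qadic_cauchy_minus assms)
qed

lemma ideal_qadic_null: "ideal (qadic_null q) (qadic_cauchy q)"
proof -
  interpret cring "qadic_cauchy q" by (rule cring_qadic_cauchy)
  show ?thesis
  proof (rule idealI)
    show "subgroup (qadic_null q) (add_monoid (qadic_cauchy q))"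
    proof (rule add.subgroupI)
      have "(\<lambda>n. 0) \<in> qadic_null q" by (simp add: qadic_null_iff)
      then show "qadic_null q \<noteq> {}" by blast
    qed (auto simp: qadic_null_cauchy qadic_null_add qadic_cauchy_uminus qadic_null_minus qadic_cauchy_simps)
  next
    fix a x assume "a \<in> qadic_null q" "x \<in> CS"
    from qadic_null_mult[OF this] show "x \<otimes>\<^bsub>qadic_cauchy q\<^esub> a \<in> qadic_null q"
        "a \<otimes>\<^bsub>qadic_cauchy q\<^esub> x \<in> qadic_null q"
      by (simp_all add: qadic_cauchy_simps mult.commute)
  qed (rule ring_axioms)
qed

lemma cring_qadic_field: "cring (qadic_field q)"
  unfolding qadic_field_def
  using ideal.quotient_is_cring[OF ideal_qadic_null cring_qadic_cauchy] .

lemma qadic_nonnull_bound: assumes "x \<in> CS" "x \<notin> qadic_null q"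
  obtains N c where "c > 0" "\<And>n. n \<ge> N \<Longrightarrow> qadic_abs q (x n) \<ge> c"
proof -
  obtain c where c: "c > 0" "\<And>N. \<exists>n\<ge>N. qadic_abs q (x n) \<ge> c"
    using assms(2) unfolding qadic_null_iff by (meson not_less)
  obtain N where N: "\<forall>m\<ge>N. \<forall>n\<ge>N. qadic_abs q (x m - x n) < c" using assms(1) c(1) unfolding qadic_cauchy_iff by blast
  obtain m where m: "m \<ge> N" "qadic_abs q (x m) \<ge> c" using c(2) by blast
  have "qadic_abs q (x n) \<ge> c" if "n \<ge> N" for n
  proof -
    have "qadic_abs q (x m - x n) < c" using N m that by simp
    moreover have "qadic_abs q (x m) \<le> max (qadic_abs q (x m - x n)) (qadic_abs q (x n))"
      using qadic_abs_add[of "x m - x n" "x n"] by simp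
    ultimately show ?thesis using m(2) by (smt (verit))
  qed
  then show ?thesis using c(1) that by blast
qed

lemma qadic_cauchy_inverse: assumes "x \<in> CS" "x \<notin> qadic_null q"
  shows "(\<lambda>n. inverse (x n)) \<in> CS" and "(\<lambda>n. x n * inverse (x n) - 1) \<in> qadic_null q"
proof -
  obtain N c where c: "c > 0" "\<And>n. n \<ge> N \<Longrightarrow> qadic_abs q (x n) \<ge> c" using qadic_nonnull_bound[OF assms] by blast
  have nz: "x n \<noteq> 0" if "n \<ge> N" for n using c that by force
  have "\<exists>K. \<forall>n\<ge>K. qadic_abs q (x n * inverse (x n) - 1) < e" if "e > 0" for e
    using nz that by (intro exI[of _ N]) simp
  then show "(\<lambda>n. x n * inverse (x n) - 1) \<in> qadic_null q" by (simp add: qadic_null_iff)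
  show "(\<lambda>n. inverse (x n)) \<in> CS"
    unfolding qadic_cauchy_iff
  proof (intro allI impI)
    fix e :: real assume e: "e > 0"
    obtain K where K: "\<forall>m\<ge>K. \<forall>n\<ge>K. qadic_abs q (x m - x n) < e * (c * c)"
      using assms(1) e c(1) unfolding qadic_cauchy_iff by (meson mult_pos_pos)
    have "qadic_abs q (inverse (x m) - inverse (x n)) < e" if "m \<ge> max K N" "n \<ge> max K N" for m n
    proof -
      have "inverse (x m) - inverse (x n) = (x n - x m) * inverse (x m * x n)"
        using nz that by (simp add: field_simps)
      then have "qadic_abs q (inverse (x m) - inverse (x n)) =
          qadic_abs q (x n - x m) / (qadic_abs q (x m) * qadic_abs q (x n))"
        by (simp add: qadic_abs_mult qadic_abs_inverse divide_inverse)
      also have "\<dots> \<le> qadic_abs q (x n - x m) / (c * c)"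
        using c that by (intro divide_left_mono mult_mono mult_pos_pos) (auto intro: less_le_trans)
      also have "\<dots> < e" using K that c(1) by (simp add: pos_divide_less_eq)
      finally show ?thesis .
    qed
    then show "\<exists>N. \<forall>m\<ge>N. \<forall>n\<ge>N. qadic_abs q (inverse (x m) - inverse (x n)) < e" by blast
  qed
qed


private abbreviation (input) "qcls x \<equiv> qadic_null q +>\<^bsub>qadic_cauchy q\<^esub> x"

lemma qadic_class_hom: "(\<lambda>x. qcls x) \<in> ring_hom (qadic_cauchy q) (qadic_field q)"
  unfolding qadic_field_def using ideal.rcos_ring_hom[OF ideal_qadic_null] by (simp add: eta_contract_eq)

lemma carrier_qadic_field: "carrier (qadic_field q) = (\<lambda>x. qcls x) ` CS"
  by (auto simp: qadic_field_def FactRing_def A_RCOSETS_def' )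

lemma qadic_class_simps:
  assumes "x \<in> CS" "y \<in> CS"
  shows "qcls x \<in> carrier (qadic_field q)"
    "qcls x \<otimes>\<^bsub>qadic_field q\<^esub> qcls y = qcls (\<lambda>n. x n * y n)"
    "qcls x \<oplus>\<^bsub>qadic_field q\<^esub> qcls y = qcls (\<lambda>n. x n + y n)"
  using ring_hom_closed[OF qadic_class_hom assms(1)] ring_hom_mult[OF qadic_class_hom assms] ring_hom_add[OF qadic_class_hom assms]
  by (simp_all add: qadic_cauchy_simps)

lemma qadic_class_one: "\<one>\<^bsub>qadic_field q\<^esub> = qcls (\<lambda>n. 1)"
  using ring_hom_one[OF qadic_class_hom] by (simp add: qadic_cauchy_simps)

lemma qadic_class_zero: "\<zero>\<^bsub>qadic_field q\<^esub> = qcls (\<lambda>n. 0)"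
  using ring_hom_zero[OF qadic_class_hom] cring_qadic_cauchy cring_qadic_field
  by (simp add: qadic_cauchy_simps cring_def)

lemma in_qadic_class: assumes "x \<in> CS" shows "y \<in> qcls x \<longleftrightarrow> (\<lambda>n. y n - x n) \<in> qadic_null q"
proof
  assume "y \<in> qcls x"
  then show "(\<lambda>n. y n - x n) \<in> qadic_null q"
    by (auto simp: a_r_coset_def' qadic_cauchy_simps)
next
  assume "(\<lambda>n. y n - x n) \<in> qadic_null q"
  then show "y \<in> qcls x"
    by (auto simp: a_r_coset_def' qadic_cauchy_simps intro!: bexI[of _ "\<lambda>n. y n - x n"])
qed

lemma qadic_class_eq_iff:
  assumes "x \<in> CS" "y \<in> CS"
  shows "qcls x = qcls y \<longleftrightarrow> (\<lambda>n. x n - y n) \<in> qadic_null q"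
proof -
  interpret ideal "qadic_null q" "qadic_cauchy q" by (rule ideal_qadic_null)
  have "x \<in> qcls y \<Longrightarrow> qcls y = qcls x"
    using a_repr_independence[OF _ assms(2)] a_subgroup by blast
  moreover have "x \<in> qcls x" by (rule a_rcos_self[OF assms(1)])
  ultimately show ?thesis using in_qadic_class[OF assms(2)] by metis
qed

lemma field_qadic_field: "field (qadic_field q)"
proof -
  interpret cring "qadic_field q" by (rule cring_qadic_field)
  show ?thesis
  proof (rule cring_fieldI2)
    have "(\<lambda>n. 0 - (1::rat)) \<notin> qadic_null q"
      by (simp add: qadic_null_def LIMSEQ_const_iff)
    then show "\<zero>\<^bsub>qadic_field q\<^esub> \<noteq> \<one>\<^bsub>qadic_field q\<^esub>"
      by (simp add: qadic_class_one qadic_class_zero qadic_class_eq_iff)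
    fix X assume "X \<in> carrier (qadic_field q)" "X \<noteq> \<zero>\<^bsub>qadic_field q\<^esub>"
    then obtain x where x0: "x \<in> CS" "X = qcls x" "qcls x \<noteq> qcls (\<lambda>n. 0)"
      by (auto simp only: carrier_qadic_field qadic_class_zero)
    then have x: "x \<in> CS" "X = qcls x" "x \<notin> qadic_null q"
      using qadic_class_eq_iff[of x "\<lambda>n. 0"] by simp_all
    show "\<exists>b\<in>carrier (qadic_field q). X \<otimes>\<^bsub>qadic_field q\<^esub> b = \<one>\<^bsub>qadic_field q\<^esub>"
      using qadic_cauchy_inverse[OF x(1,3)] x(1)
      by (intro bexI[of _ "qcls (\<lambda>n. inverse (x n))"])
         (simp_all add: x(2) qadic_class_simps qadic_class_one qadic_class_eq_iff qadic_cauchy_mult)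
  qed
qed

lemma qadic_class_rep: "x \<in> qcls y \<Longrightarrow> y \<in> CS \<Longrightarrow> x \<in> CS \<and> qcls x = qcls y"
  using qadic_null_cauchy qadic_cauchy_add[of "\<lambda>n. x n - y n" y] by (auto simp: in_qadic_class qadic_class_eq_iff)

lemma qadic_integers_iff:
  "X \<in> qadic_integers q \<longleftrightarrow> (\<exists>x\<in>CS. X = qcls x \<and> (\<forall>n. qadic_abs q (x n) \<le> 1))" (is "_ \<longleftrightarrow> ?R")
proof
  assume "X \<in> qadic_integers q"
  then obtain y x where "X = qcls y" "y \<in> CS" "x \<in> qcls y" "\<forall>n. qadic_abs q (x n) \<le> 1"
    by (auto simp: qadic_integers_def carrier_qadic_field)
  then show ?R using qadic_class_rep by metis
next
  assume ?R
  then obtain x where x: "x \<in> CS" "X = qcls x" "\<forall>n. qadic_abs q (x n) \<le> 1" by blast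
  moreover have "x \<in> qcls x" using x by (simp add: in_qadic_class qadic_null_iff)
  ultimately show "X \<in> qadic_integers q"
    unfolding qadic_integers_def carrier_qadic_field by blast
qed

lemma subring_qadic_integers: "subring (qadic_integers q) (qadic_field q)"
proof -
  interpret cring "qadic_field q" by (rule cring_qadic_field)
  show ?thesis
  proof (rule subringI)
    show "qadic_integers q \<subseteq> carrier (qadic_field q)" by (auto simp: qadic_integers_def)
    show "\<one>\<^bsub>qadic_field q\<^esub> \<in> qadic_integers q"
      unfolding qadic_integers_iff by (intro bexI[of _ "\<lambda>n. 1"]) (auto simp: qadic_class_one)
    fix X assume "X \<in> qadic_integers q"
    then obtain x where x: "x \<in> CS" "X = qcls x" "\<forall>n. qadic_abs q (x n) \<le> 1"
      by (auto simp: qadic_integers_iff)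
    have "\<ominus>\<^bsub>qadic_field q\<^esub> X = qcls (\<lambda>n. - x n)"
      by (rule minus_equality) (use x in \<open>simp_all add: qadic_class_simps qadic_cauchy_minus qadic_class_zero\<close>)
    then show "\<ominus>\<^bsub>qadic_field q\<^esub> X \<in> qadic_integers q"
      unfolding qadic_integers_iff using x by (intro bexI[of _ "\<lambda>n. - x n"]) (auto simp: qadic_cauchy_minus)
    fix Y assume "Y \<in> qadic_integers q"
    then obtain y where y: "y \<in> CS" "Y = qcls y" "\<forall>n. qadic_abs q (y n) \<le> 1"
      by (auto simp: qadic_integers_iff)
    have "qadic_abs q (x n * y n) \<le> 1" for n
      using x y by (simp add: qadic_abs_mult mult_le_one)
    then show "X \<otimes>\<^bsub>qadic_field q\<^esub> Y \<in> qadic_integers q"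
      unfolding qadic_integers_iff using x y
      by (intro bexI[of _ "\<lambda>n. x n * y n"]) (auto simp: qadic_cauchy_mult qadic_class_simps)
    have "qadic_abs q (x n + y n) \<le> 1" for n
      using order_trans[OF qadic_abs_add[of "x n" "y n"]] x y by simp
    then show "X \<oplus>\<^bsub>qadic_field q\<^esub> Y \<in> qadic_integers q"
      unfolding qadic_integers_iff using x y
      by (intro bexI[of _ "\<lambda>n. x n + y n"]) (auto simp: qadic_cauchy_add qadic_class_simps)
  qed
qed

lemma rat_to_qadic_hom: "rat_to_qadic q \<in> ring_hom rat_field (qadic_field q)"
  by (rule ring_hom_memI) (simp_all add: rat_to_qadic_def rat_field_def qadic_class_simps qadic_class_one
      qadic_class_simps(1)[OF _ qadic_cauchy_const])

lemma rat_to_qadic_integer: "rat_to_qadic q r \<in> qadic_integers q \<longleftrightarrow> qadic_abs q r \<le> 1"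
proof
  assume "qadic_abs q r \<le> 1"
  then show "rat_to_qadic q r \<in> qadic_integers q"
    unfolding qadic_integers_iff rat_to_qadic_def by (intro bexI[of _ "\<lambda>n. r"]) auto
next
  assume "rat_to_qadic q r \<in> qadic_integers q"
  then obtain x where x: "x \<in> CS" "qcls (\<lambda>n. r) = qcls x" "\<forall>n. qadic_abs q (x n) \<le> 1"
    unfolding qadic_integers_iff rat_to_qadic_def by blast
  then have "(\<lambda>n. r - x n) \<in> qadic_null q" by (simp add: qadic_class_eq_iff)
  then obtain N where "qadic_abs q (r - x N) < 1" unfolding qadic_null_iff by (metis order_refl zero_less_one)
  then show "qadic_abs q r \<le> 1"
    using qadic_abs_add[of "r - x N" "x N"] x(3)[rule_format, of N] by simp
qed

lemma rat_to_qadic_inj: "rat_to_qadic q r = rat_to_qadic q s \<longleftrightarrow> r = s"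
proof
  assume "rat_to_qadic q r = rat_to_qadic q s"
  then have "(\<lambda>n. r - s) \<in> qadic_null q" by (simp add: rat_to_qadic_def qadic_class_eq_iff)
  then have "\<forall>e>0. qadic_abs q (r - s) < e" unfolding qadic_null_iff by blast
  then show "r = s" using qadic_abs_pos[of "r - s"] by fastforce
qed simp

end

section \<open>Properties of the Heisenberg monoids\<close>

lemma mat2_carrier: "carrier (mat2 R) = (carrier R \<times> carrier R) \<times> (carrier R \<times> carrier R)"
  by (simp add: mat2_def)

context cring
begin

lemma mat2_assoc_entry:
  "\<lbrakk>a \<in> carrier R; b \<in> carrier R; c \<in> carrier R; d \<in> carrier R; e \<in> carrier R; f \<in> carrier R; g \<in> carrier R; h \<in> carrier R\<rbrakk> \<Longrightarrow>
   (a \<otimes> c \<oplus> b \<otimes> e) \<otimes> g \<oplus> (a \<otimes> d \<oplus> b \<otimes> f) \<otimes> h =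
   a \<otimes> (c \<otimes> g \<oplus> d \<otimes> h) \<oplus> b \<otimes> (e \<otimes> g \<oplus> f \<otimes> h)"
  by (simp add: l_distr r_distr m_assoc a_assoc a_lcomm)

lemma mat2_det_entry:
  "\<lbrakk>a \<in> carrier R; b \<in> carrier R; c \<in> carrier R; d \<in> carrier R; e \<in> carrier R; f \<in> carrier R; g \<in> carrier R; h \<in> carrier R\<rbrakk> \<Longrightarrow>
   (a \<otimes> e \<oplus> b \<otimes> g) \<otimes> (c \<otimes> f \<oplus> d \<otimes> h) \<ominus> (a \<otimes> f \<oplus> b \<otimes> h) \<otimes> (c \<otimes> e \<oplus> d \<otimes> g) =
   (a \<otimes> d \<ominus> b \<otimes> c) \<otimes> (e \<otimes> h \<ominus> f \<otimes> g)"
  by algebra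

lemma heis_assoc_entry:
  "\<lbrakk>a \<in> carrier R; b \<in> carrier R; e \<in> carrier R; f \<in> carrier R; g \<in> carrier R; h \<in> carrier R; x \<in> carrier R; y \<in> carrier R; u \<in> carrier R; s \<in> carrier R; t \<in> carrier R; v \<in> carrier R; p \<in> carrier R\<rbrakk> \<Longrightarrow>
   (a \<otimes> e \<oplus> b \<otimes> g) \<otimes> x \<oplus> (a \<otimes> f \<oplus> b \<otimes> h) \<otimes> y \<oplus> u \<otimes> (a \<otimes> s \<oplus> b \<otimes> t \<oplus> v \<otimes> p) =
   a \<otimes> (e \<otimes> x \<oplus> f \<otimes> y \<oplus> u \<otimes> s) \<oplus> b \<otimes> (g \<otimes> x \<oplus> h \<otimes> y \<oplus> u \<otimes> t) \<oplus> v \<otimes> u \<otimes> p"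
  by algebra

lemma mat2_mult_closed:
  "A \<in> carrier (mat2 R) \<Longrightarrow> B \<in> carrier (mat2 R) \<Longrightarrow> A \<otimes>\<^bsub>mat2 R\<^esub> B \<in> carrier (mat2 R)"
  by (auto simp: mat2_def)

lemma monoid_mat2: "monoid (mat2 R)"
proof (rule monoidI)
  fix A B C assume "A \<in> carrier (mat2 R)" "B \<in> carrier (mat2 R)" "C \<in> carrier (mat2 R)"
  then show "A \<otimes>\<^bsub>mat2 R\<^esub> B \<otimes>\<^bsub>mat2 R\<^esub> C = A \<otimes>\<^bsub>mat2 R\<^esub> (B \<otimes>\<^bsub>mat2 R\<^esub> C)"
    by (auto simp: mat2_def mat2_assoc_entry)
qed (auto simp: mat2_def)

lemma mat2_vec_closed:
  "A \<in> carrier (mat2 R) \<Longrightarrow> v \<in> carrier R \<times> carrier R \<Longrightarrow> mat2_vec R A v \<in> carrier R \<times> carrier R"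
  by (auto simp: mat2_def mat2_vec_def)

lemma mat2_det_closed: "A \<in> carrier (mat2 R) \<Longrightarrow> mat2_det R A \<in> carrier R"
  by (auto simp: mat2_def mat2_det_def)

lemma mat2_det_mult:
  "A \<in> carrier (mat2 R) \<Longrightarrow> B \<in> carrier (mat2 R) \<Longrightarrow>
   mat2_det R (A \<otimes>\<^bsub>mat2 R\<^esub> B) = mat2_det R A \<otimes> mat2_det R B"
  by (auto simp: mat2_def mat2_det_def mat2_det_entry)

lemma mat2_det_one: "mat2_det R \<one>\<^bsub>mat2 R\<^esub> = \<one>"
  by (simp add: mat2_def mat2_det_def minus_eq)

lemma GL2_iff_det: "A \<in> GL2 R \<longleftrightarrow> A \<in> carrier (mat2 R) \<and> mat2_det R A \<in> Units R"
proof safe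
  assume A: "A \<in> GL2 R"
  then show A': "A \<in> carrier (mat2 R)" by (auto simp: Units_def)
  from A obtain B where B: "B \<in> carrier (mat2 R)" "A \<otimes>\<^bsub>mat2 R\<^esub> B = \<one>\<^bsub>mat2 R\<^esub>" by (auto simp: Units_def)
  then have 1: "mat2_det R A \<otimes> mat2_det R B = \<one>" using A' mat2_det_mult mat2_det_one by metis
  have c: "mat2_det R A \<in> carrier R" "mat2_det R B \<in> carrier R" using A' B mat2_det_closed by auto
  show "mat2_det R A \<in> Units R"
    using 1 c m_comm[OF c] by (auto simp: Units_def)
next
  assume A: "A \<in> carrier (mat2 R)" "mat2_det R A \<in> Units R"
  obtain a b c d where abcd: "A = ((a, b), (c, d))" by (metis surj_pair)
  have in_R: "a \<in> carrier R" "b \<in> carrier R" "c \<in> carrier R" "d \<in> carrier R"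
    using A(1) by (auto simp: abcd mat2_def)
  obtain u where u: "u \<in> carrier R" "u \<otimes> (a \<otimes> d \<ominus> b \<otimes> c) = \<one>"
    using A(2) by (auto simp: Units_def abcd mat2_det_def)
  let ?B = "((u \<otimes> d, \<ominus> (u \<otimes> b)), (\<ominus> (u \<otimes> c), u \<otimes> a))"
  have "u \<otimes> a \<otimes> d \<ominus> u \<otimes> b \<otimes> c = \<one>"
    using u(1) in_R by (subst u(2)[symmetric]) algebra
  moreover have "a \<otimes> (u \<otimes> d) \<oplus> b \<otimes> \<ominus> (u \<otimes> c) = u \<otimes> a \<otimes> d \<ominus> u \<otimes> b \<otimes> c"
    "c \<otimes> \<ominus> (u \<otimes> b) \<oplus> d \<otimes> (u \<otimes> a) = u \<otimes> a \<otimes> d \<ominus> u \<otimes> b \<otimes> c"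
    "u \<otimes> d \<otimes> a \<oplus> \<ominus> (u \<otimes> b) \<otimes> c = u \<otimes> a \<otimes> d \<ominus> u \<otimes> b \<otimes> c"
    "\<ominus> (u \<otimes> c) \<otimes> b \<oplus> u \<otimes> a \<otimes> d = u \<otimes> a \<otimes> d \<ominus> u \<otimes> b \<otimes> c"
    "a \<otimes> \<ominus> (u \<otimes> b) \<oplus> b \<otimes> (u \<otimes> a) = \<zero>" "c \<otimes> (u \<otimes> d) \<oplus> d \<otimes> \<ominus> (u \<otimes> c) = \<zero>"
    "u \<otimes> d \<otimes> b \<oplus> \<ominus> (u \<otimes> b) \<otimes> d = \<zero>" "\<ominus> (u \<otimes> c) \<otimes> a \<oplus> u \<otimes> a \<otimes> c = \<zero>"
    using u(1) in_R by algebra+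
  ultimately have "A \<otimes>\<^bsub>mat2 R\<^esub> ?B = \<one>\<^bsub>mat2 R\<^esub>" "?B \<otimes>\<^bsub>mat2 R\<^esub> A = \<one>\<^bsub>mat2 R\<^esub>"
    by (auto simp: abcd mat2_def)
  moreover have "?B \<in> carrier (mat2 R)" using u(1) in_R by (simp add: mat2_def)
  ultimately show "A \<in> GL2 R" using A(1) by (auto simp: Units_def)
qed

lemma heis_mult_assoc:
  assumes "x \<in> carrier (heis R)" "y \<in> carrier (heis R)" "z \<in> carrier (heis R)"
  shows "x \<otimes>\<^bsub>heis R\<^esub> y \<otimes>\<^bsub>heis R\<^esub> z = x \<otimes>\<^bsub>heis R\<^esub> (y \<otimes>\<^bsub>heis R\<^esub> z)"
proof -
  interpret M: monoid "mat2 R" by (rule monoid_mat2)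
  obtain A a B b C c where e: "x = (A, a)" "y = (B, b)" "z = (C, c)" by (metis surj_pair)
  have in_M: "A \<in> carrier (mat2 R)" "B \<in> carrier (mat2 R)" "C \<in> carrier (mat2 R)"
    using assms by (auto simp: e heis_def)
  have in_V: "a \<in> carrier R \<times> carrier R" "b \<in> carrier R \<times> carrier R" "c \<in> carrier R \<times> carrier R"
    using assms by (auto simp: e heis_def)
  have D: "mat2_det R C \<in> carrier R" "mat2_det R B \<in> carrier R" using in_M mat2_det_closed by auto
  have "vec2_add R (mat2_vec R (A \<otimes>\<^bsub>mat2 R\<^esub> B) c)
      (vec2_smult R u (vec2_add R (mat2_vec R A b) (vec2_smult R v a))) =
    vec2_add R (mat2_vec R A (vec2_add R (mat2_vec R B c) (vec2_smult R u b)))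
      (vec2_smult R (v \<otimes> u) a)" if "u \<in> carrier R" "v \<in> carrier R" for u v
    using that in_M in_V by (auto simp: mat2_def vec2_add_def mat2_vec_def vec2_smult_def heis_assoc_entry)
  from this[OF D] show ?thesis
    using in_M by (simp add: e heis_def M.m_assoc mat2_det_mult)
qed

lemma group_heis: "group (heis R)"
proof (rule groupI)
  interpret M: monoid "mat2 R" by (rule monoid_mat2)
  have vec: "vec2_add R (mat2_vec R A b) (vec2_smult R u a) \<in> carrier R \<times> carrier R"
    if "A \<in> carrier (mat2 R)" "b \<in> carrier R \<times> carrier R" "u \<in> carrier R" "a \<in> carrier R \<times> carrier R"
    for A b u a
    using that by (auto simp: mat2_def vec2_add_def mat2_vec_def vec2_smult_def)
  show "x \<otimes>\<^bsub>heis R\<^esub> y \<in> carrier (heis R)" if "x \<in> carrier (heis R)" "y \<in> carrier (heis R)" for x y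
    using that vec[OF M.Units_closed _ mat2_det_closed[OF M.Units_closed]]
    by (auto simp: heis_def split: prod.splits) 
  show "\<one>\<^bsub>heis R\<^esub> \<in> carrier (heis R)" by (simp add: heis_def)
  show "x \<otimes>\<^bsub>heis R\<^esub> y \<otimes>\<^bsub>heis R\<^esub> z = x \<otimes>\<^bsub>heis R\<^esub> (y \<otimes>\<^bsub>heis R\<^esub> z)"
    if "x \<in> carrier (heis R)" "y \<in> carrier (heis R)" "z \<in> carrier (heis R)" for x y z
    using heis_mult_assoc that by blast
  show "\<one>\<^bsub>heis R\<^esub> \<otimes>\<^bsub>heis R\<^esub> x = x" if x: "x \<in> carrier (heis R)" for x
  proof -
    obtain A a where e: "x = (A, a)" by (metis surj_pair)
    have A: "A \<in> carrier (mat2 R)" "a \<in> carrier R \<times> carrier R" using x by (auto simp: e heis_def)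
    have "vec2_add R (mat2_vec R \<one>\<^bsub>mat2 R\<^esub> a) (vec2_smult R (mat2_det R A) (\<zero>, \<zero>)) = a"
      using A(2) mat2_det_closed[OF A(1)] by (auto simp: mat2_def vec2_add_def mat2_vec_def vec2_smult_def)
    then show ?thesis using A by (simp add: e heis_def)
  qed
  show "\<exists>y\<in>carrier (heis R). y \<otimes>\<^bsub>heis R\<^esub> x = \<one>\<^bsub>heis R\<^esub>" if x: "x \<in> carrier (heis R)" for x
  proof -
    obtain A a1 a2 where e: "x = (A, (a1, a2))" by (metis surj_pair)
    have A: "A \<in> GL2 R" "a1 \<in> carrier R" "a2 \<in> carrier R" using x by (auto simp: e heis_def)
    define B where "B = inv\<^bsub>mat2 R\<^esub> A"
    have B: "B \<in> GL2 R" "B \<otimes>\<^bsub>mat2 R\<^esub> A = \<one>\<^bsub>mat2 R\<^esub>" using A by (simp_all add: B_def)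
    obtain v1 v2 where v: "mat2_vec R B (a1, a2) = (v1, v2)" by (metis surj_pair)
    have v': "v1 \<in> carrier R" "v2 \<in> carrier R"
      using v A mat2_vec_closed[OF M.Units_closed[OF B(1)], of "(a1, a2)"] by simp_all
    have "mat2_det R A \<in> Units R" using A GL2_iff_det by blast
    then obtain u where u: "u \<in> carrier R" "mat2_det R A \<otimes> u = \<one>" by (auto simp: Units_def)
    have d: "mat2_det R A \<in> carrier R" using A mat2_det_closed M.Units_closed by blast
    have "v \<oplus> mat2_det R A \<otimes> \<ominus> (u \<otimes> v) = v \<ominus> (mat2_det R A \<otimes> u) \<otimes> v" if "v \<in> carrier R" for v
      using d u(1) that by algebra
    then have z: "v \<oplus> mat2_det R A \<otimes> \<ominus> (u \<otimes> v) = \<zero>" if "v \<in> carrier R" for v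
      using that by (simp add: u(2) minus_eq r_neg)
    have "(B, (\<ominus> (u \<otimes> v1), \<ominus> (u \<otimes> v2))) \<otimes>\<^bsub>heis R\<^esub> x = \<one>\<^bsub>heis R\<^esub>"
      using B(2) z[OF v'(1)] z[OF v'(2)] by (simp add: e heis_def v vec2_add_def vec2_smult_def)
    moreover have "(B, (\<ominus> (u \<otimes> v1), \<ominus> (u \<otimes> v2))) \<in> carrier (heis R)"
      using B(1) u v' by (simp add: heis_def)
    ultimately show ?thesis by blast
  qed
qed

end

lemma heis_Gamma_subset_Delta:
  assumes "cring K" "subring Z K"
  shows "heis_Gamma K Z \<subseteq> heis_Delta K Z"
proof -
  have "GL2 (K\<lparr>carrier := Z\<rparr>) \<subseteq> GL2 K"
    using subringE(1)[OF assms(2)] by (auto simp: Units_def mat2_def; blast)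
  then show ?thesis unfolding heis_Gamma_def heis_Delta_def by (auto simp: Units_def)
qed

lemma field_rat_field: "field rat_field"
proof -
  have "cring rat_field"
  proof (rule cringI)
    show "abelian_group rat_field"
    proof (rule abelian_groupI)
      show "\<exists>y\<in>carrier rat_field. y \<oplus>\<^bsub>rat_field\<^esub> x = \<zero>\<^bsub>rat_field\<^esub>" for x
        by (intro bexI[of _ "- x"]) (auto simp: rat_field_def)
    qed (auto simp: rat_field_def)
    show "comm_monoid rat_field" by (rule comm_monoidI) (auto simp: rat_field_def)
  qed (auto simp: rat_field_def algebra_simps)
  then show ?thesis
  proof (rule cring.cring_fieldI2)
    show "\<exists>b\<in>carrier rat_field. a \<otimes>\<^bsub>rat_field\<^esub> b = \<one>\<^bsub>rat_field\<^esub>" if "a \<noteq> \<zero>\<^bsub>rat_field\<^esub>" for a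
      using that by (intro bexI[of _ "inverse a"]) (auto simp: rat_field_def)
  qed (simp add: rat_field_def)
qed

lemma subring_Ints: "subring \<int> rat_field"
proof -
  interpret field rat_field by (rule field_rat_field)
  have m: "\<ominus>\<^bsub>rat_field\<^esub> x = - x" for x
    by (rule minus_equality) (auto simp: rat_field_def)
  show ?thesis
  proof (rule subringI)
    show "\<And>h. h \<in> \<int> \<Longrightarrow> \<ominus>\<^bsub>rat_field\<^esub> h \<in> \<int>" by (simp add: m)
  qed (auto simp: rat_field_def)
qed

lemma local_embed_in_Delta_hat:
  assumes "a \<in> Delta_Hq p"
  shows "local_embed p a \<in> Delta_hat"
proof -
  have "\<one>\<^bsub>heis (qadic_field q)\<^esub> \<in> Gamma_Hq q \<and> Gamma_Hq q \<subseteq> Delta_Hq q" if "prime q" for q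
  proof -
    interpret cring "qadic_field q" using cring_qadic_field[OF that] .
    have s: "subring (qadic_integers q) (qadic_field q)" using subring_qadic_integers[OF that] .
    then interpret Z: cring "qadic_field q\<lparr>carrier := qadic_integers q\<rparr>"
      using subcringI'[OF s] subcring_iff[OF subringE(1)[OF s]] by blast
    interpret M: monoid "mat2 (qadic_field q\<lparr>carrier := qadic_integers q\<rparr>)" by (rule Z.monoid_mat2)
    have "\<one>\<^bsub>mat2 (qadic_field q\<lparr>carrier := qadic_integers q\<rparr>)\<^esub> \<in> GL2 (qadic_field q\<lparr>carrier := qadic_integers q\<rparr>)"
      by simp
    then have "\<one>\<^bsub>heis (qadic_field q)\<^esub> \<in> Gamma_Hq q"
      using subringE(2)[OF s] by (simp add: heis_def Gamma_Hq_def heis_Gamma_def mat2_def)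
    then show ?thesis using heis_Gamma_subset_Delta[OF is_cring s] by (simp add: Gamma_Hq_def Delta_Hq_def)
  qed
  moreover from this have "{q. prime q \<and> local_embed p a q \<notin> Gamma_Hq q} \<subseteq> {p}"
    by (auto simp: local_embed_def)
  moreover from calculation(1) have "local_embed p a \<in> (\<Pi>\<^sub>E q\<in>{q. prime q}. Delta_Hq q)"
    using assms by (auto simp: local_embed_def; blast)
  ultimately show ?thesis by (auto simp: Delta_hat_def intro: finite_subset)
qed

lemma eta_H_in_Delta_hat:
  assumes "x \<in> Delta_H"
  shows "eta_H x \<in> Delta_hat"
proof -
  interpret Q: field rat_field by (rule field_rat_field)
  obtain a b c d s t where x: "x = (((a, b), (c, d)), (s, t))" by (metis surj_pair)
  have Z: "a \<in> \<int>" "b \<in> \<int>" "c \<in> \<int>" "d \<in> \<int>" "s \<in> \<int>" "t \<in> \<int>"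
    using assms by (auto simp: x Delta_H_def heis_Delta_def mat2_def)
  have m: "\<ominus>\<^bsub>rat_field\<^esub> x = - x" for x
    by (rule Q.minus_equality) (auto simp: rat_field_def)
  define D where "D = a * d - b * c"
  have D: "mat2_det rat_field ((a, b), (c, d)) = D"
    by (simp add: D_def mat2_det_def a_minus_def m) (simp add: rat_field_def)
  have "D \<in> Units rat_field" using assms Q.GL2_iff_det D by (auto simp: x Delta_H_def heis_Delta_def)
  then have D0: "D \<noteq> 0" by (auto simp: Units_def rat_field_def)
  have "D \<in> \<int>" using Z by (simp add: D_def)
  then obtain k where k: "D = of_int k" "k \<noteq> 0" using D0 by (auto elim!: Ints_cases)
  have loc: "eta_H x q \<in> Delta_Hq q \<and> (\<not> int q dvd k \<longrightarrow> eta_H x q \<in> Gamma_Hq q)" if q: "prime q" for q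
  proof -
    interpret K: field "qadic_field q" using field_qadic_field[OF q] .
    have s: "subring (qadic_integers q) (qadic_field q)" using subring_qadic_integers[OF q] .
    then interpret Z: cring "qadic_field q\<lparr>carrier := qadic_integers q\<rparr>"
      using K.subcringI'[OF s] K.subcring_iff[OF subringE(1)[OF s]] by blast
    let ?i = "rat_to_qadic q"
    have int: "?i r \<in> qadic_integers q" if "r \<in> \<int>" for r
      using that rat_to_qadic_integer[OF q] qadic_abs_of_int_le[OF q] by (auto elim!: Ints_cases)
    interpret h: ring_hom_ring rat_field "qadic_field q" ?i
      using rat_to_qadic_hom[OF q] Q.ring_axioms K.ring_axioms by (simp add: ring_hom_ringI2)
    have car: "carrier rat_field = UNIV" by (simp add: rat_field_def)
    have det: "mat2_det (qadic_field q) ((?i a, ?i b), (?i c, ?i d)) = ?i D"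
      unfolding D[symmetric] by (simp add: mat2_det_def a_minus_def car)
    have e: "eta_H x q = (((?i a, ?i b), (?i c, ?i d)), (?i s, ?i t))"
      using q by (simp add: eta_H_def x Let_def)
    have "?i D \<noteq> \<zero>\<^bsub>qadic_field q\<^esub>"
      using rat_to_qadic_inj[OF q, of D 0] D0 h.hom_zero by (simp add: rat_field_def)
    then have "?i D \<in> Units (qadic_field q)" by (simp add: K.field_Units car)
    then have 1: "eta_H x q \<in> Delta_Hq q"
      using Z int det by (simp add: e Delta_Hq_def heis_Delta_def K.GL2_iff_det mat2_carrier
          subsetD[OF subringE(1)[OF s]])
    have "eta_H x q \<in> Gamma_Hq q" if nd: "\<not> int q dvd k"
    proof -
      have "qadic_abs q (inverse D) = 1"
        using nd k by (simp add: qadic_abs_inverse[OF q] qadic_abs_of_int[OF q] not_dvd_imp_multiplicity_0)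
      then have "?i (inverse D) \<in> qadic_integers q" by (simp add: rat_to_qadic_integer[OF q])
      moreover have "?i D \<otimes>\<^bsub>qadic_field q\<^esub> ?i (inverse D) = \<one>\<^bsub>qadic_field q\<^esub>"
        using D0 h.hom_mult[of D "inverse D"] h.hom_one by (simp add: rat_field_def)
      moreover have "?i D \<in> qadic_integers q" using \<open>D \<in> \<int>\<close> int by blast
      ultimately have "?i D \<in> Units (qadic_field q\<lparr>carrier := qadic_integers q\<rparr>)"
        using K.m_comm[of "?i D" "?i (inverse D)"] subringE(1)[OF s]
        by (auto simp: Units_def intro!: bexI[of _ "?i (inverse D)"])
      moreover have "mat2_det (qadic_field q\<lparr>carrier := qadic_integers q\<rparr>) ((?i a, ?i b), (?i c, ?i d)) = ?i D"
      proof -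
        have "?i b \<otimes>\<^bsub>qadic_field q\<^esub> ?i c \<in> qadic_integers q" using int Z subringE(6)[OF s] by blast
        then show ?thesis
          using det K.add.m_inv_consistent[OF subring.axioms(1)[OF s]] by (simp add: mat2_det_def a_minus_def a_inv_def)
      qed
      ultimately show ?thesis
        using Z int by (simp add: e Gamma_Hq_def heis_Gamma_def Z.GL2_iff_det mat2_carrier)
    qed
    with 1 show ?thesis by blast
  qed
  have "finite {q :: nat. int q dvd k}"
    using finite_vimageI[OF finite_divisors_int[OF k(2)], of int] by (simp add: vimage_def)
  moreover have "{q. prime q \<and> eta_H x q \<notin> Gamma_Hq q} \<subseteq> {q. int q dvd k}" using loc by blast
  moreover have "eta_H x \<in> (\<Pi>\<^sub>E q\<in>{q. prime q}. Delta_Hq q)"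
    using loc by (auto simp: PiE_iff) (simp add: eta_H_def)
  ultimately show ?thesis by (auto simp: Delta_hat_def intro: finite_subset)
qed

end

theory Submission
  imports Defs
begin

text \<open>A double coset of \<open>(A, a)\<close> is governed by the class of \<open>a\<close> modulo \<open>A \<int>\<^sup>2\<close>, up to the action
  \<open>a \<mapsto> det V U a\<close> of the pairs with \<open>U A V = A\<close>. Take \<open>A = diag(p\<^sup>3, p\<^sup>9)\<close> and \<open>a = (x, p\<^sup>3 y)\<close>:
  then \<open>U\<close> is upper triangular modulo \<open>p\<^sup>6\<close>, and the action multiplies \<open>x y\<close> modulo \<open>p\<^sup>3\<close> by
  \<open>det U\<close> times \<open>(det V)\<^sup>2\<close>, that is, by \<open>det V\<close>. This is an arbitrary unit over the p-adic integers
  but only \<open>\<plusminus>1\<close> over \<open>\<int>\<close>, and \<open>1 + p\<close> is a unit different from \<open>\<plusminus>1\<close> modulo \<open>p\<^sup>3\<close>. Hence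
  \<open>(1, p\<^sup>3)\<close> and \<open>(1, p\<^sup>3 (1 + p))\<close> are equivalent locally but not globally.\<close>

section \<open>The rational Heisenberg monoid in coordinates\<close>

lemma rat_field_simps:
  "carrier rat_field = UNIV" "x \<otimes>\<^bsub>rat_field\<^esub> y = x * y" "x \<oplus>\<^bsub>rat_field\<^esub> y = x + y"
  "\<one>\<^bsub>rat_field\<^esub> = 1" "\<zero>\<^bsub>rat_field\<^esub> = 0"
  by (simp_all add: rat_field_def)

lemma rat_field_uminus: "\<ominus>\<^bsub>rat_field\<^esub> x = - x"
proof -
  interpret field rat_field by (rule field_rat_field)
  show ?thesis by (rule minus_equality) (auto simp: rat_field_simps)
qed

lemma mat2_det_rat: "mat2_det rat_field ((a, b), (c, d)) = a * d - b * c"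
  by (simp add: mat2_det_def a_minus_def rat_field_uminus rat_field_simps)

lemma Units_rat_field: "Units rat_field = UNIV - {0}"
  using field.field_Units[OF field_rat_field] by (simp add: rat_field_simps)

lemma heis_rat_mult:
  "(((a, b), (c, d)), (s, t)) \<otimes>\<^bsub>heis rat_field\<^esub> (((a', b'), (c', d')), (s', t')) =
   (((a * a' + b * c', a * b' + b * d'), (c * a' + d * c', c * b' + d * d')),
    (a * s' + b * t' + (a' * d' - b' * c') * s, c * s' + d * t' + (a' * d' - b' * c') * t))"
  by (simp add: heis_def mat2_def vec2_add_def mat2_vec_def vec2_smult_def mat2_det_rat rat_field_simps)

lemma Delta_H_iff:
  "(((a, b), (c, d)), (s, t)) \<in> Delta_H \<longleftrightarrow>
   a \<in> \<int> \<and> b \<in> \<int> \<and> c \<in> \<int> \<and> d \<in> \<int> \<and> s \<in> \<int> \<and> t \<in> \<int> \<and> a * d - b * c \<noteq> 0"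
proof -
  interpret field rat_field by (rule field_rat_field)
  show ?thesis
    by (auto simp: Delta_H_def heis_Delta_def GL2_iff_det mat2_carrier mat2_det_rat
        Units_rat_field rat_field_simps)
qed

lemma Gamma_H_subset_Delta_H: "Gamma_H \<subseteq> Delta_H"
  unfolding Gamma_H_def Delta_H_def
  using field_rat_field subring_Ints by (intro heis_Gamma_subset_Delta) (auto simp: field_def domain_def)

text \<open>The determinant is multiplicative and integral, so it is a unit of the integers. This
  scarcity of units is what separates the global from the local situation.\<close>

lemma Gamma_H_det:
  assumes "(((a, b), (c, d)), v) \<in> Gamma_H"
  shows "a * d - b * c = 1 \<or> a * d - b * c = - 1"
proof -
  let ?Z = "rat_field\<lparr>carrier := \<int>\<rparr>"
  interpret field rat_field by (rule field_rat_field)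
  have A: "((a, b), (c, d)) \<in> GL2 ?Z"
    using assms by (simp add: Gamma_H_def heis_Gamma_def)
  then obtain a' b' c' d' where Z: "a \<in> \<int>" "b \<in> \<int>" "c \<in> \<int>" "d \<in> \<int>" "a' \<in> \<int>" "b' \<in> \<int>" "c' \<in> \<int>" "d' \<in> \<int>"
    and AB: "((a, b), (c, d)) \<otimes>\<^bsub>mat2 rat_field\<^esub> ((a', b'), (c', d')) = \<one>\<^bsub>mat2 rat_field\<^esub>"
    by (auto simp: Units_def mat2_def)
  have "mat2_det rat_field ((a, b), (c, d)) * mat2_det rat_field ((a', b'), (c', d')) = 1"
    using mat2_det_mult[of "((a, b), (c, d))" "((a', b'), (c', d'))"] mat2_det_one AB
    by (simp add: mat2_carrier rat_field_simps)
  then have 1: "(a * d - b * c) * (a' * d' - b' * c') = 1" by (simp only: mat2_det_rat)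
  have "a * d - b * c \<in> \<int>" "a' * d' - b' * c' \<in> \<int>" using Z by auto
  then obtain k l where kl: "a * d - b * c = of_int k" "a' * d' - b' * c' = of_int l"
    by (auto elim!: Ints_cases)
  with 1 have "k * l = 1" by (metis of_int_mult of_int_eq_1_iff)
  then have "k = 1 \<or> k = - 1" by (auto simp: zmult_eq_1_iff)
  with kl show ?thesis by auto
qed

section \<open>The diagonal embedding, prime by prime\<close>

lemma rat_to_qadic_ring_hom_ring:
  assumes "prime q"
  shows "ring_hom_ring rat_field (qadic_field q) (rat_to_qadic q)"
  using assms rat_to_qadic_hom field_rat_field cring_qadic_field
  by (intro ring_hom_ringI2) (auto simp: field_def domain_def cring_def)

lemma eta_H_apply:
  assumes "prime q"
  shows "eta_H (((a, b), (c, d)), (s, t)) q =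
    (((rat_to_qadic q a, rat_to_qadic q b), (rat_to_qadic q c, rat_to_qadic q d)),
     (rat_to_qadic q s, rat_to_qadic q t))"
  using assms by (simp add: eta_H_def Let_def)

text \<open>The product is polynomial in the entries, so a ring homomorphism applied entrywise
  respects it.\<close>

lemma eta_H_mult:
  assumes "prime q"
  shows "eta_H (x \<otimes>\<^bsub>heis rat_field\<^esub> y) q = eta_H x q \<otimes>\<^bsub>heis (qadic_field q)\<^esub> eta_H y q"
proof -
  interpret h: ring_hom_ring rat_field "qadic_field q" "rat_to_qadic q"
    using rat_to_qadic_ring_hom_ring[OF assms] .
  obtain a b c d s t where x: "x = (((a, b), (c, d)), (s, t))" by (metis surj_pair)
  obtain a' b' c' d' s' t' where y: "y = (((a', b'), (c', d')), (s', t'))" by (metis surj_pair)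
  show ?thesis
    by (simp add: x y heis_def mat2_def vec2_add_def mat2_vec_def vec2_smult_def mat2_det_def
        a_minus_def eta_H_apply[OF assms] rat_field_simps(1))
qed

lemma eta_H_one:
  assumes "prime q"
  shows "eta_H \<one>\<^bsub>heis rat_field\<^esub> q = \<one>\<^bsub>heis (qadic_field q)\<^esub>"
proof -
  interpret h: ring_hom_ring rat_field "qadic_field q" "rat_to_qadic q"
    using rat_to_qadic_ring_hom_ring[OF assms] .
  show ?thesis by (simp add: heis_def mat2_def eta_H_apply[OF assms])
qed

text \<open>A determinant of absolute value 1 has a q-integral inverse. The entries may be any
  q-integral rationals, which admits local units such as 1/t.\<close>

lemma eta_H_in_Gamma_Hq:
  assumes q: "prime q"
    and int: "qadic_abs q a \<le> 1" "qadic_abs q b \<le> 1" "qadic_abs q c \<le> 1" "qadic_abs q d \<le> 1"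
      "qadic_abs q s \<le> 1" "qadic_abs q t \<le> 1"
    and det: "qadic_abs q (a * d - b * c) = 1"
  shows "eta_H (((a, b), (c, d)), (s, t)) q \<in> Gamma_Hq q"
proof -
  let ?i = "rat_to_qadic q"
  let ?Z = "qadic_field q\<lparr>carrier := qadic_integers q\<rparr>"
  interpret K: field "qadic_field q" using field_qadic_field[OF q] .
  have s: "subring (qadic_integers q) (qadic_field q)" using subring_qadic_integers[OF q] .
  then interpret Z: cring ?Z
    using K.subcringI'[OF s] K.subcring_iff[OF subringE(1)[OF s]] by blast
  interpret h: ring_hom_ring rat_field "qadic_field q" ?i
    using rat_to_qadic_ring_hom_ring[OF q] .
  define D where "D = a * d - b * c"
  have D: "qadic_abs q D = 1" using det by (simp add: D_def)
  then have D0: "D \<noteq> 0" by auto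
  have iZ: "?i a \<in> qadic_integers q" "?i b \<in> qadic_integers q" "?i c \<in> qadic_integers q"
    "?i d \<in> qadic_integers q" "?i s \<in> qadic_integers q" "?i t \<in> qadic_integers q"
    using int by (simp_all add: rat_to_qadic_integer[OF q])
  have iD: "?i D \<in> qadic_integers q" "?i (inverse D) \<in> qadic_integers q"
    using D by (simp_all add: rat_to_qadic_integer[OF q] qadic_abs_inverse[OF q])
  have "?i D \<otimes>\<^bsub>qadic_field q\<^esub> ?i (inverse D) = \<one>\<^bsub>qadic_field q\<^esub>"
    using D0 h.hom_mult[of D "inverse D"] h.hom_one by (simp add: rat_field_simps)
  with iD have "?i D \<in> Units ?Z"
    using K.m_comm[of "?i D" "?i (inverse D)"] subringE(1)[OF s]
    by (auto simp: Units_def intro!: bexI[of _ "?i (inverse D)"])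
  moreover have "mat2_det ?Z ((?i a, ?i b), (?i c, ?i d)) = ?i D"
  proof -
    have "mat2_det (qadic_field q) ((?i a, ?i b), (?i c, ?i d)) = ?i D"
      unfolding D_def mat2_det_rat[symmetric] by (simp add: mat2_det_def a_minus_def rat_field_simps(1))
    \<comment> \<open>Negation in \<open>?Z\<close> is formed inside the subring; it agrees with
      negation in the field on elements of the subring, such as this product.\<close>
    moreover have "?i b \<otimes>\<^bsub>qadic_field q\<^esub> ?i c \<in> qadic_integers q" using iZ subringE(6)[OF s] by blast
    ultimately show ?thesis
      using K.add.m_inv_consistent[OF subring.axioms(1)[OF s]]
      by (simp add: mat2_det_def a_minus_def a_inv_def)
  qed
  ultimately show ?thesis
    using iZ by (simp add: eta_H_apply[OF q] Gamma_Hq_def heis_Gamma_def Z.GL2_iff_det mat2_carrier)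
qed

lemma one_in_Gamma_Hq:
  assumes "prime q"
  shows "\<one>\<^bsub>heis (qadic_field q)\<^esub> \<in> Gamma_Hq q"
proof -
  have "eta_H (((1, 0), (0, 1)), (0, 0)) q \<in> Gamma_Hq q"
    using assms by (intro eta_H_in_Gamma_Hq) simp_all
  then show ?thesis
    using eta_H_one[OF assms] by (simp add: heis_def mat2_def rat_field_simps)
qed

lemma Delta_Hq_subset_heis:
  assumes "prime q"
  shows "Delta_Hq q \<subseteq> carrier (heis (qadic_field q))"
  using subringE(1)[OF subring_qadic_integers[OF assms]]
  by (auto simp: Delta_Hq_def heis_Delta_def heis_def)

lemma Gamma_Hq_subset_Delta_Hq:
  assumes "prime q"
  shows "Gamma_Hq q \<subseteq> Delta_Hq q"
  unfolding Gamma_Hq_def Delta_Hq_def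
  using heis_Gamma_subset_Delta[OF cring_qadic_field[OF assms] subring_qadic_integers[OF assms]] .

text \<open>Reduces the adelic condition to one equation at p: elsewhere the embedded element is the
  identity, and \<open>eta_H x\<close> itself can serve as the left factor.\<close>

lemma in_eta_fibre_local_embed:
  assumes p: "prime p" and x: "x \<in> Delta_H"
    and away: "\<And>q. prime q \<Longrightarrow> q \<noteq> p \<Longrightarrow> eta_H x q \<in> Gamma_Hq q"
    and gh: "g \<in> Gamma_Hq p" "h \<in> Gamma_Hq p"
    and eq: "eta_H x p = g \<otimes>\<^bsub>heis (qadic_field p)\<^esub> \<alpha> \<otimes>\<^bsub>heis (qadic_field p)\<^esub> h"
  shows "x \<in> eta_fibre (local_embed p \<alpha>)"
proof -
  define G where "G = (\<lambda>q\<in>{q. prime q}. if q = p then g else eta_H x q)"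
  define H where "H = (\<lambda>q\<in>{q. prime q}. if q = p then h else \<one>\<^bsub>heis (qadic_field q)\<^esub>)"
  have "G \<in> Gamma_hat" "H \<in> Gamma_hat"
    using gh away one_in_Gamma_Hq by (auto simp: G_def H_def Gamma_hat_def)
  moreover have "eta_H x = G \<otimes>\<^bsub>heis_hat\<^esub> local_embed p \<alpha> \<otimes>\<^bsub>heis_hat\<^esub> H"
  proof (rule ext)
    fix q
    show "eta_H x q = (G \<otimes>\<^bsub>heis_hat\<^esub> local_embed p \<alpha> \<otimes>\<^bsub>heis_hat\<^esub> H) q"
    proof (cases "prime q \<and> q \<noteq> p")
      case True
      then have q: "prime q" by simp
      interpret group "heis (qadic_field q)"
        using cring.group_heis[OF cring_qadic_field[OF q]] .
      have "eta_H x q \<in> carrier (heis (qadic_field q))"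
        using away True Delta_Hq_subset_heis Gamma_Hq_subset_Delta_Hq by blast
      then show ?thesis
        using True by (simp add: heis_hat_def product_group_def G_def H_def local_embed_def)
    next
      \<comment> \<open>At a non-prime index both sides are \<open>undefined\<close>.\<close>
      case False
      then show ?thesis
        using p eq by (cases "q = p")
          (auto simp: heis_hat_def product_group_def G_def H_def local_embed_def eta_H_def)
    qed
  qed
  ultimately show ?thesis using x by (auto simp: eta_fibre_def double_coset_def)
qed

section \<open>Local equivalence of the diagonal elements\<close>

text \<open>With Q = p^3 the matrix is diag(Q, Q^3). The choice Q = p^2 would fail for p = 2, where
  1 + p is -1 modulo 4.\<close>

definition diag_elt :: "nat \<Rightarrow> int \<Rightarrow> rat mat2 \<times> rat vec2" where
  "diag_elt p t = (((of_nat p ^ 3, 0), (0, of_nat p ^ 9)), (1, of_nat p ^ 3 * of_int t))"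

lemma qadic_abs_of_int_not_dvd:
  assumes "prime q" "\<not> int q dvd k"
  shows "qadic_abs q (of_int k) = 1"
proof -
  have "k \<noteq> 0" using assms by auto
  then show ?thesis using assms by (simp add: qadic_abs_of_int not_dvd_imp_multiplicity_0)
qed

lemma diag_elt_in_Delta_H:
  assumes "prime p"
  shows "diag_elt p t \<in> Delta_H"
  using prime_gt_0_nat[OF assms] by (simp add: diag_elt_def Delta_H_iff)

text \<open>The determinant p^12 is a unit at q.\<close>

lemma eta_H_diag_elt_in_Gamma_Hq:
  assumes p: "prime p" and q: "prime q" "q \<noteq> p"
  shows "eta_H (diag_elt p t) q \<in> Gamma_Hq q"
proof -
  have "\<not> int q dvd int p" using p q primes_dvd_imp_eq by auto
  then have 1: "qadic_abs q (of_nat p) = 1" using qadic_abs_of_int_not_dvd[OF q(1), of "int p"] by simp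
  have pow: "qadic_abs q (of_nat p ^ n) = 1" for n
    by (induction n) (simp_all add: qadic_abs_mult[OF q(1)] q(1) 1)
  show ?thesis
    unfolding diag_elt_def
    by (rule eta_H_in_Gamma_Hq)
      (simp_all add: q(1) qadic_abs_mult[OF q(1)] pow qadic_abs_of_int_le[OF q(1)])
qed

text \<open>Conjugating by the p-adically integral matrix \<open>diag(1/t, 1)\<close> absorbs the unit \<open>t\<close>.\<close>

lemma diag_elt_in_eta_fibre:
  assumes p: "prime p" and t: "\<not> int p dvd t"
  shows "diag_elt p t \<in> eta_fibre (local_embed p (eta_H (diag_elt p 1) p))"
proof -
  \<comment> \<open>\<open>U\<close> turns the vector (1, Q) into (1/t, Q), and det V = t scales
    this to (1, Q t); the diagonal matrix is restored.\<close>
  define U :: "rat mat2 \<times> rat vec2" where "U = (((inverse (of_int t), 0), (0, 1)), (0, 0))"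
  define V :: "rat mat2 \<times> rat vec2" where "V = (((of_int t, 0), (0, 1)), (0, 0))"
  have abs: "qadic_abs p (of_int t) = 1" using qadic_abs_of_int_not_dvd[OF p t] .
  have t0: "t \<noteq> 0" using t by auto
  show ?thesis
  proof (rule in_eta_fibre_local_embed[OF p diag_elt_in_Delta_H[OF p] eta_H_diag_elt_in_Gamma_Hq[OF p]])
    show "eta_H U p \<in> Gamma_Hq p" "eta_H V p \<in> Gamma_Hq p"
      unfolding U_def V_def
      by (rule eta_H_in_Gamma_Hq; simp add: p abs qadic_abs_inverse)+
    have "diag_elt p t = U \<otimes>\<^bsub>heis rat_field\<^esub> diag_elt p 1 \<otimes>\<^bsub>heis rat_field\<^esub> V"
      using t0 by (simp add: U_def V_def diag_elt_def heis_rat_mult)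
    then show "eta_H (diag_elt p t) p =
        eta_H U p \<otimes>\<^bsub>heis (qadic_field p)\<^esub> eta_H (diag_elt p 1) p \<otimes>\<^bsub>heis (qadic_field p)\<^esub> eta_H V p"
      by (simp add: eta_H_mult[OF p])
  qed
qed

section \<open>Global inequivalence\<close>

text \<open>With \<open>Q = p\<^sup>3\<close>, the assumptions \<open>mat\<close> and \<open>vec\<close> are the entries of
  \<open>(U, u) (A, (1, Q)) (V, v) = (A, (1, Q t))\<close>.\<close>

lemma unit_from_integral_equivalence:
  fixes Q a b c d a' b' c' d' u1 u2 v1 v2 t e :: int
  assumes Q: "Q > 0"
    and det: "a' * d' - b' * c' = e" "e = 1 \<or> e = - 1"
    and mat: "a * Q * a' + b * Q ^ 3 * c' = Q" "a * Q * b' + b * Q ^ 3 * d' = 0"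
      "c * Q * a' + d * Q ^ 3 * c' = 0" "c * Q * b' + d * Q ^ 3 * d' = Q ^ 3"
    and vec: "a * Q * v1 + b * Q ^ 3 * v2 + e * (a + b * Q + Q ^ 4 * u1) = 1"
      "c * Q * v1 + d * Q ^ 3 * v2 + e * (c + d * Q + Q ^ 4 * u2) = Q * t"
  shows "Q dvd t - e"
proof -
  have e2: "e * e = 1" using det by auto
  \<comment> \<open>Cramer's rule on the second row of \<open>mat\<close> eliminates
    \<open>d\<close> and shows that Q^2 divides \<open>c\<close>.\<close>
  have "Q * (e * c) = c * Q * (a' * d' - b' * c')" using det(1) by simp
  also have "\<dots> = (c * Q * a' + d * Q ^ 3 * c') * d' - (c * Q * b' + d * Q ^ 3 * d') * c'"
    by (simp add: algebra_simps)
  also have "\<dots> = Q * (- (Q ^ 2 * c'))" unfolding mat by (simp add: eval_nat_numeral)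
  finally have ec: "e * c = - (Q ^ 2 * c')" using Q by (subst (asm) mult_cancel_left) simp
  have "c = e * (e * c)" using e2 by (simp flip: mult.assoc)
  then have c: "c = Q ^ 2 * (- e * c')" unfolding ec by simp
  \<comment> \<open>Comparing determinants in U A V = A gives det U = e, because e is its own
    inverse.\<close>
  have "Q * Q ^ 3 * ((a * d - b * c) * (a' * d' - b' * c')) =
      (a * Q * a' + b * Q ^ 3 * c') * (c * Q * b' + d * Q ^ 3 * d') -
      (a * Q * b' + b * Q ^ 3 * d') * (c * Q * a' + d * Q ^ 3 * c')"
    by (simp add: algebra_simps)
  also have "\<dots> = Q * Q ^ 3 * 1" unfolding mat by simp
  finally have "(a * d - b * c) * e = 1" unfolding det(1) using Q by simp
  then have "(a * d - b * c) * (e * e) = e" by (simp flip: mult.assoc)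
  then have ad: "a * d - b * c = e" by (simp add: e2)
  define k where "k = - e * c'"
  have ck: "c = Q ^ 2 * k" using c by (simp add: k_def)
  have "Q * t = Q * (Q ^ 2 * k * v1 + d * Q ^ 2 * v2 + e * (Q * k + d + Q ^ 3 * u2))"
    unfolding vec(2)[symmetric] ck by (simp add: algebra_simps eval_nat_numeral)
  then have t: "t = Q ^ 2 * k * v1 + d * Q ^ 2 * v2 + e * (Q * k + d + Q ^ 3 * u2)" using Q by simp
  \<comment> \<open>Modulo Q the vector equations become t = e d and e a = 1, with \<open>r\<close>
    and \<open>s\<close> collecting the multiples of Q. Since Q divides c, also a d = e, and so t =
    (e a)(e d) = a d = e.\<close>
  define r where "r = Q * k * v1 + d * Q * v2 + e * (k + Q ^ 2 * u2)"
  have t': "t = e * d + Q * r" unfolding r_def t by (simp add: algebra_simps eval_nat_numeral)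
  define s where "s = a * v1 + b * Q ^ 2 * v2 + e * (b + Q ^ 3 * u1)"
  have "e * a + Q * s = 1" unfolding s_def vec(1)[symmetric] by (simp add: algebra_simps eval_nat_numeral)
  then have "e * d = (e * a + Q * s) * (e * d)" by simp
  also have "\<dots> = (e * e) * (a * d) + Q * (s * e * d)" by (simp add: algebra_simps eval_nat_numeral)
  also have "a * d = e + Q * (b * Q * k)" using ad unfolding ck by (simp add: algebra_simps eval_nat_numeral)
  finally have "t - e = Q * (r + s * e * d + b * Q * k)"
    unfolding t' e2 by (simp add: algebra_simps)
  then show ?thesis by simp
qed

lemma diag_elt_double_coset:
  assumes p: "prime p"
    and "diag_elt p t \<in> double_coset (heis rat_field) Gamma_H (diag_elt p 1)"
  shows "int p ^ 3 dvd t - 1 \<or> int p ^ 3 dvd t + 1"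
proof -
  obtain g h where gh: "g \<in> Gamma_H" "h \<in> Gamma_H"
    "diag_elt p t = g \<otimes>\<^bsub>heis rat_field\<^esub> diag_elt p 1 \<otimes>\<^bsub>heis rat_field\<^esub> h"
    using assms(2) by (auto simp: double_coset_def)
  obtain a b c d u1 u2 where g: "g = (((a, b), (c, d)), (u1, u2))" by (metis surj_pair)
  obtain a' b' c' d' v1 v2 where h: "h = (((a', b'), (c', d')), (v1, v2))" by (metis surj_pair)
  have "g \<in> Delta_H" "h \<in> Delta_H" using gh Gamma_H_subset_Delta_H by auto
  then obtain A B C D U1 U2 A' B' C' D' V1 V2 where of_int:
    "a = of_int A" "b = of_int B" "c = of_int C" "d = of_int D" "u1 = of_int U1" "u2 = of_int U2"
    "a' = of_int A'" "b' = of_int B'" "c' = of_int C'" "d' = of_int D'" "v1 = of_int V1" "v2 = of_int V2"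
    by (auto simp: g h Delta_H_iff elim!: Ints_cases)
  let ?Q = "int p ^ 3"
  define e where "e = A' * D' - B' * C'"
  have "(of_int e :: rat) = 1 \<or> (of_int e :: rat) = of_int (- 1)"
    using Gamma_H_det[OF gh(2)[unfolded h]] by (simp add: e_def of_int)
  then have e1: "e = 1 \<or> e = - 1" by (simp only: of_int_eq_iff of_int_eq_1_iff)
  \<comment> \<open>The six coordinates of the equation, written as images of integers so that
    injectivity of \<open>of_int\<close> brings them to the integers. The factor
    \<open>?Q ^ 4\<close> is the determinant p^12.\<close>
  have "(of_int (A * ?Q * A' + B * ?Q ^ 3 * C') :: rat) = of_int (?Q)"
    "(of_int (A * ?Q * B' + B * ?Q ^ 3 * D') :: rat) = of_int 0"
    "(of_int (C * ?Q * A' + D * ?Q ^ 3 * C') :: rat) = of_int 0"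
    "(of_int (C * ?Q * B' + D * ?Q ^ 3 * D') :: rat) = of_int (?Q ^ 3)"
    "(of_int (A * ?Q * V1 + B * ?Q ^ 3 * V2 + e * (A + B * ?Q + ?Q ^ 4 * U1)) :: rat) = of_int 1"
    "(of_int (C * ?Q * V1 + D * ?Q ^ 3 * V2 + e * (C + D * ?Q + ?Q ^ 4 * U2)) :: rat)
      = of_int (?Q * t)"
    using gh(3) by (simp_all add: g h of_int diag_elt_def heis_rat_mult e_def flip: power_add power_mult)
  then have "?Q dvd t - e"
    unfolding of_int_eq_iff using prime_gt_0_nat[OF p] e_def e1
    by (intro unit_from_integral_equivalence[of ?Q A' D' B' C' e A B C D V1 V2 U1 U2 t]) simp_all
  with e1 show ?thesis by auto
qed

text \<open>Turns equality of two double cosets into a relation between their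
  representatives.\<close>

lemma in_double_coset_self: "x \<in> double_coset (heis rat_field) Gamma_H x"
proof -
  obtain a b c d s t where x: "x = (((a, b), (c, d)), (s, t))" by (metis surj_pair)
  have "(((1, 0), (0, 1)), (0, 0)) \<in> Gamma_H"
    by (auto simp: Gamma_H_def heis_Gamma_def Units_def mat2_def rat_field_simps)
  moreover have "x = (((1, 0), (0, 1)), (0, 0)) \<otimes>\<^bsub>heis rat_field\<^esub> x
      \<otimes>\<^bsub>heis rat_field\<^esub> (((1, 0), (0, 1)), (0, 0))"
    by (simp add: x heis_rat_mult)
  ultimately show ?thesis unfolding double_coset_def by blast
qed

theorem theorem4p1:
  fixes p :: nat
  assumes "prime p"
  shows "\<exists>\<alpha>\<in>Delta_Hq p.
    \<exists>C\<in>double_cosets (heis rat_field) Gamma_H (eta_fibre (local_embed p \<alpha>)).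
    \<exists>D\<in>double_cosets (heis rat_field) Gamma_H (eta_fibre (local_embed p \<alpha>)). C \<noteq> D"
proof -
  let ?\<alpha> = "eta_H (diag_elt p 1) p"
  let ?t = "1 + int p"
  let ?C = "double_coset (heis rat_field) Gamma_H"
  have p2: "p \<ge> 2" using prime_ge_2_nat[OF assms] .
  have "?\<alpha> \<in> Delta_Hq p"
    using eta_H_in_Delta_hat[OF diag_elt_in_Delta_H[OF assms]] assms
    by (auto simp: Delta_hat_def)
  moreover have "diag_elt p 1 \<in> eta_fibre (local_embed p ?\<alpha>)"
    using p2 by (intro diag_elt_in_eta_fibre[OF assms]) auto
  moreover have "diag_elt p ?t \<in> eta_fibre (local_embed p ?\<alpha>)"
    using p2 by (intro diag_elt_in_eta_fibre[OF assms]) (auto simp: dvd_add_left_iff)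
  moreover have "?C (diag_elt p ?t) \<noteq> ?C (diag_elt p 1)"
  proof
    assume "?C (diag_elt p ?t) = ?C (diag_elt p 1)"
    then have "diag_elt p ?t \<in> ?C (diag_elt p 1)" using in_double_coset_self by metis
    then have "int p ^ 3 dvd int p \<or> int p ^ 3 dvd int p + 2"
      using diag_elt_double_coset[OF assms] by (force simp: algebra_simps)
    then have "int p ^ 3 \<le> int p \<or> int p ^ 3 \<le> int p + 2"
      using p2 zdvd_imp_le[of "int p ^ 3"] by force
    \<comment> \<open>Thus p^3 is at least 4p, which exceeds both t - 1 = p and t + 1 = p +
      2.\<close>
    moreover have "int p * (2 * 2) \<le> int p * (int p * int p)"
      using p2 by (intro mult_left_mono mult_mono) auto
    ultimately show False using p2 by (simp add: power3_eq_cube)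
  qed
  ultimately show ?thesis unfolding double_cosets_def by blast
qed

end
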